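(* Let $A,B\in\mathbb{C}^{n\times n}$, and let $B$ be strictly diagonally dominant. Then $\Gamma_i^S(A,B)=\Gamma_i^B(A,B)$ for all $i$, and, denoting by $\lambda_1,\dots,\lambda_n$ the $n$ finite eigenvalues of the pencil $A-\lambda B$, every $\lambda_k$ ($1\le k\le n$) satisfies \[\lambda_k\in\Gamma^S(A,B)=\bigcup_{1\le i\le n}\Gamma_i^B(A,B).\]
   Context: Write $A=(a_{i,j})$, $B=(b_{i,j})$. The $i$th row of a matrix $M=(m_{i,j})$ is strictly diagonally dominant if $|m_{i,i}|>\sum_{j\ne i}|m_{i,j}|$; $M$ is strictly diagonally dominant if all its rows are. A finite eigenvalue of the pencil $A-\lambda B$ is a $\lambda\in\mathbb{C}$ with $\det(A-\lambda B)=0$; when $B$ is nonsingular there are $n$ of them (with multiplicity), namely those of $B^{-1}A$. All regions are subsets of $\mathbb{C}\cup\{\infty\}$. Let $S^B$ (resp. $S^A$) be the set of $i$ such that the $i$th row of $B$ (resp. $A$) is strictly diagonally dominant. For $i\in S^B$ let $r_i=\sum_{j\ne i}|b_{i,j}|/|b_{i,i}|\;(<1)$, $R_i=\sum_{j\neq i}|a_{i,j}|$, $\rho_i=\frac{|a_{i,i}|r_i+R_i}{|b_{i,i}|(1-r_i)}$, and $\Gamma_i^B(A,B)=\{z\in\mathbb{C}:|z-a_{i,i}/b_{i,i}|\le\rho_i\}$. For $i\in S^A$ let $r_i^A=\sum_{j\ne i}|a_{i,j}|/|a_{i,i}|\;(<1)$ and $R_i^A=\sum_{j\ne i}|b_{i,j}|$.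 If $b_{i,i}=R_i^A=0$, then $\Gamma_i^A(A,B)=\{\infty\}$. If $b_{i,i}=0$ and $R_i^A>0$, then $\Gamma_i^A(A,B)=\{z\in\mathbb{C}:|z|\ge\frac{|a_{i,i}|}{R_i^A}(1-r_i^A)\}\cup\{\infty\}$. If $b_{i,i}\ne0$, let $\alpha_i=\frac{a_{i,i}}{b_{i,i}}$, $\beta_i=\frac{|b_{i,i}|r_i^A+R_i^A}{|b_{i,i}|(1-r_i^A)}$ and, when $\beta_i\neq1$, $c_i=\frac{\alpha_i}{1-\beta_i^2}$, $\rho_i^A=\frac{|\alpha_i|\beta_i}{|1-\beta_i^2|}$; then $\Gamma_i^A(A,B)$ is $\{z\in\mathbb{C}:|z-c_i|\le\rho_i^A\}$ if $\beta_i<1$, $\{z\in\mathbb{C}:|z-c_i|\ge\rho_i^A\}\cup\{\infty\}$ if $\beta_i>1$, and $\{z\in\mathbb{C}:|z-\alpha_i|\le|z|\}\cup\{\infty\}$ if $\beta_i=1$. For $i\notin S^A$, $\Gamma_i^A(A,B)$ is the whole plane, including $\infty$. $\Gamma_i^S(A,B)=\Gamma_i^B(A,B)$ if $i\in S^B$, $\Gamma_i^S(A,B)=\Gamma_i^A(A,B)$ if $i\notin S^B$, and $\Gamma^S(A,B)=\bigcup_{1\le i\le n}\Gamma_i^S(A,B)$. *)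

theory Defs
  imports "HOL-Analysis.Analysis" "HOL-Computational_Algebra.Computational_Algebra"
begin

definition offdiag_sum :: "complex^'n^'n \<Rightarrow> 'n::finite \<Rightarrow> real" where
  "offdiag_sum M i = (\<Sum>j\<in>UNIV - {i}. cmod (M $ i $ j))"

definition sdd_row :: "complex^'n^'n \<Rightarrow> 'n::finite \<Rightarrow> bool" where
  "sdd_row M i \<longleftrightarrow> cmod (M $ i $ i) > offdiag_sum M i"

definition strictly_diagonally_dominant :: "complex^'n^'n::finite \<Rightarrow> bool" where
  "strictly_diagonally_dominant M \<longleftrightarrow> (\<forall>i. sdd_row M i)"

definition finite_eigenvalue :: "complex^'n^'n \<Rightarrow> complex^'n^'n::finite \<Rightarrow> complex \<Rightarrow> bool" where
  "finite_eigenvalue A B z \<longleftrightarrow> det (\<chi> i j. A $ i $ j - z * B $ i $ j) = 0"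

text \<open>The polynomial \<open>det (A - x B)\<close> in the indeterminate \<open>x\<close>.\<close>

definition pencil_poly :: "complex^'n^'n \<Rightarrow> complex^'n^'n::finite \<Rightarrow> complex poly" where
  "pencil_poly A B = det (\<chi> i j. [:A $ i $ j, - (B $ i $ j):])"

text \<open>
  The finite eigenvalues counted with multiplicity. For a singular pencil (\<open>pencil_poly A B = 0\<close>)
  every complex number is a finite eigenvalue, but \<^const>\<open>proots\<close> returns the empty multiset;
  only regular pencils are relevant here.
\<close>

definition finite_eigenvalues :: "complex^'n^'n \<Rightarrow> complex^'n^'n::finite \<Rightarrow> complex multiset" where
  "finite_eigenvalues A B = proots (pencil_poly A B)"

lemma poly_det:
  fixes M :: "'a::comm_ring_1 poly^'n^'n::finite"
  shows "poly (det M) z = det (\<chi> i j. poly (M $ i $ j) z)"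
  by (simp add: det_def poly_sum poly_prod)

lemma poly_pencil_poly:
  "poly (pencil_poly A B) z = det (\<chi> i j. A $ i $ j - z * B $ i $ j)"
  by (simp add: pencil_poly_def poly_det)

lemma set_mset_finite_eigenvalues:
  assumes "pencil_poly A B \<noteq> 0"
  shows "set_mset (finite_eigenvalues A B) = {z. finite_eigenvalue A B z}"
  using assms by (simp add: finite_eigenvalues_def finite_eigenvalue_def poly_pencil_poly)

text \<open>
  Regions are subsets of the extended plane, represented by \<^typ>\<open>complex option\<close>:
  \<open>Some z\<close> is the finite point \<open>z\<close> and \<^const>\<open>None\<close> is \<open>\<infinity>\<close>.
\<close>

text \<open>\<open>Gamma_B\<close> is meaningful only for \<open>i\<close> with \<open>sdd_row B i\<close>.\<close>

definition Gamma_B :: "complex^'n^'n \<Rightarrow> complex^'n^'n \<Rightarrow> 'n::finite \<Rightarrow> complex option set" where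
  "Gamma_B A B i =
    (let a = A $ i $ i; b = B $ i $ i;
         r = offdiag_sum B i / cmod b;
         R = offdiag_sum A i;
         \<rho> = (cmod a * r + R) / (cmod b * (1 - r))
     in Some ` {z. cmod (z - a / b) \<le> \<rho>})"

definition Gamma_A :: "complex^'n^'n \<Rightarrow> complex^'n^'n \<Rightarrow> 'n::finite \<Rightarrow> complex option set" where
  "Gamma_A A B i =
    (if \<not> sdd_row A i then UNIV
     else
       (let a = A $ i $ i; b = B $ i $ i;
            r = offdiag_sum A i / cmod a;
            R = offdiag_sum B i
        in
          if b = 0 then
            (if R = 0 then {None}
             else insert None (Some ` {z. cmod z \<ge> cmod a / R * (1 - r)}))
          else
            (let \<alpha> = a / b;
                 \<beta> = (cmod b * r + R) / (cmod b * (1 - r));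
                 c = \<alpha> / of_real (1 - \<beta>\<^sup>2);
                 \<rho> = cmod \<alpha> * \<beta> / \<bar>1 - \<beta>\<^sup>2\<bar>
             in
               if \<beta> < 1 then Some ` {z. cmod (z - c) \<le> \<rho>}
               else if \<beta> > 1 then insert None (Some ` {z. cmod (z - c) \<ge> \<rho>})
               else insert None (Some ` {z. cmod (z - \<alpha>) \<le> cmod z}))))"

definition Gamma_S_row :: "complex^'n^'n \<Rightarrow> complex^'n^'n \<Rightarrow> 'n::finite \<Rightarrow> complex option set" where
  "Gamma_S_row A B i = (if sdd_row B i then Gamma_B A B i else Gamma_A A B i)"

definition Gamma_S :: "complex^'n^'n \<Rightarrow> complex^'n^'n::finite \<Rightarrow> complex option set" where
  "Gamma_S A B = (\<Union>i. Gamma_S_row A B i)"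

end

theory Submission
  imports Defs
begin

text \<open>
  A singular matrix has a row that is not strictly diagonally dominant: take a row in which a
  kernel vector has its largest entry. For \<open>A - z B\<close> this gives
  \<open>|a\<^sub>i\<^sub>i - z b\<^sub>i\<^sub>i| \<le> R\<^sub>i + |z| r\<^sub>i |b\<^sub>i\<^sub>i|\<close>, and bounding \<open>|z|\<close> by
  \<open>|z - a\<^sub>i\<^sub>i/b\<^sub>i\<^sub>i| + |a\<^sub>i\<^sub>i/b\<^sub>i\<^sub>i|\<close> turns it into the disc \<open>\<Gamma>\<^sub>i\<^sup>B\<close>. For \<open>-B\<close> it
  shows that the coefficient of \<open>x\<^sup>n\<close> in \<open>det (A - x B)\<close>, which is \<open>det (-B)\<close>, does not vanish.
\<close>

lemma det_zero_imp_not_sdd_row: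
  fixes M :: "complex^'n^'n::finite"
  assumes "det M = 0"
  shows "\<exists>i. \<not> sdd_row M i"
proof -
  have "\<not> invertible M"
    using assms by (simp add: invertible_det_nz)
  then obtain v where v: "M *v v = 0" "v \<noteq> 0"
    using matrix_left_invertible_ker[of M] by (auto simp: invertible_left_inverse)
  define m where "m = Max (range (\<lambda>j. cmod (v $ j)))"
  have "m \<in> range (\<lambda>j. cmod (v $ j))"
    unfolding m_def by (rule Max_in) auto
  then obtain i where i: "m = cmod (v $ i)"
    by auto
  have le: "cmod (v $ j) \<le> cmod (v $ i)" for j
    unfolding i[symmetric] m_def by (rule Max_ge) auto
  \<comment> \<open>Some nonzero entry forces the largest modulus to be positive, so
    \<open>cmod (v $ i)\<close> can be cancelled at the end.\<close>
  obtain k where "v $ k \<noteq> 0"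
    using v(2) by (auto simp: vec_eq_iff)
  with le[of k] have pos: "cmod (v $ i) > 0"
    by (smt (verit) zero_less_norm_iff)
  have "(\<Sum>j\<in>UNIV. M $ i $ j * v $ j) = 0"
    using v(1) by (simp add: matrix_vector_mult_def vec_eq_iff)
  then have "M $ i $ i * v $ i = - (\<Sum>j\<in>UNIV - {i}. M $ i $ j * v $ j)"
    by (simp add: sum.remove[of UNIV i] eq_neg_iff_add_eq_0)
  then have "cmod (M $ i $ i) * cmod (v $ i) = cmod (\<Sum>j\<in>UNIV - {i}. M $ i $ j * v $ j)"
    by (metis norm_minus_cancel norm_mult)
  also have "\<dots> \<le> (\<Sum>j\<in>UNIV - {i}. cmod (M $ i $ j) * cmod (v $ i))"
    by (rule sum_norm_le) (simp add: norm_mult mult_left_mono le)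
  also have "\<dots> = offdiag_sum M i * cmod (v $ i)"
    by (simp add: offdiag_sum_def sum_distrib_right)
  finally show ?thesis
    using pos by (auto simp: sdd_row_def not_less intro!: exI[of _ i])
qed

text \<open>Both claims go through one induction: multiplying by \<open>[:a x, b x:]\<close> adds
  \<open>a x\<close> times the coefficient of the old product at \<open>Suc (card S)\<close>, which
  the degree bound makes zero. Some \<open>b i\<close> may vanish, so the degree is only
  bounded.\<close>

lemma prod_linear_poly_degree_coeff:
  fixes a b :: "'b \<Rightarrow> 'a::comm_ring_1"
  assumes "finite S"
  shows "degree (\<Prod>i\<in>S. [:a i, b i:]) \<le> card S \<and>
         coeff (\<Prod>i\<in>S. [:a i, b i:]) (card S) = (\<Prod>i\<in>S. b i)"
  using assms
proof (induction S)
  case (insert x S)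
  let ?q = "\<Prod>i\<in>S. [:a i, b i:]"
  have "degree ([:a x, b x:] * ?q) \<le> degree [:a x, b x:] + degree ?q"
    by (rule degree_mult_le)
  also have "\<dots> \<le> Suc (card S)"
    using insert.IH by simp
  finally have "degree ([:a x, b x:] * ?q) \<le> Suc (card S)" .
  moreover have "coeff ?q (Suc (card S)) = 0"
    using insert.IH by (simp add: coeff_eq_0)
  ultimately show ?case
    using insert by simp
qed simp

lemma degree_pencil_poly_le:
  fixes A B :: "complex^'n^'n::finite"
  shows "degree (pencil_poly A B) \<le> CARD('n)"
  unfolding pencil_poly_def det_def
proof (rule degree_sum_le)
  fix p :: "'n \<Rightarrow> 'n"
  let ?q = "\<Prod>i\<in>UNIV. (\<chi> i j. [:A $ i $ j, - (B $ i $ j):]) $ i $ p i"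
  have "degree (of_int (sign p) * ?q) \<le> degree (of_int (sign p) :: complex poly) + degree ?q"
    by (rule degree_mult_le)
  also have "\<dots> \<le> CARD('n)"
    using prod_linear_poly_degree_coeff[of UNIV "\<lambda>i. A $ i $ p i" "\<lambda>i. - (B $ i $ p i)"]
    by simp
  finally show "degree (of_int (sign p) * ?q) \<le> CARD('n)" .
qed (simp add: finite_permutations)

text \<open>In the Leibniz expansion, the term of a permutation \<open>p\<close> contributes its
  sign times the product of the \<open>- (B $ i $ p i)\<close>.\<close>

lemma coeff_pencil_poly_card:
  fixes A B :: "complex^'n^'n::finite"
  shows "coeff (pencil_poly A B) CARD('n) = det (- B)"
  by (simp add: pencil_poly_def det_def coeff_sum of_int_poly
      prod_linear_poly_degree_coeff[OF finite, THEN conjunct2])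

text \<open>The exact degree serves twice: it makes the pencil regular and it counts the
  eigenvalues. Negating \<open>B\<close> leaves all moduli, hence dominance, unchanged.\<close>

lemma degree_pencil_poly:
  fixes A B :: "complex^'n^'n::finite"
  assumes "strictly_diagonally_dominant B"
  shows "degree (pencil_poly A B) = CARD('n)"
proof (rule antisym[OF degree_pencil_poly_le le_degree])
  have "\<forall>i. sdd_row (- B) i"
    using assms by (simp add: strictly_diagonally_dominant_def sdd_row_def offdiag_sum_def)
  then show "coeff (pencil_poly A B) CARD('n) \<noteq> 0"
    using det_zero_imp_not_sdd_row[of "- B"] by (auto simp: coeff_pencil_poly_card)
qed

lemma finite_eigenvalue_in_Gamma_B:
  fixes A B :: "complex^'n^'n::finite"
  assumes B: "strictly_diagonally_dominant B" and z: "finite_eigenvalue A B z"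
  shows "\<exists>i. Some z \<in> Gamma_B A B i"
proof -
  let ?M = "\<chi> i j. A $ i $ j - z * B $ i $ j"
  obtain i where "\<not> sdd_row ?M i"
    using z det_zero_imp_not_sdd_row[of ?M] by (auto simp: finite_eigenvalue_def)
  define a b r R where "a = A $ i $ i" and "b = B $ i $ i"
    and "r = offdiag_sum B i / cmod b" and "R = offdiag_sum A i"
  define w where "w = z - a / b"
  have sdd: "offdiag_sum B i < cmod b"
    using B by (simp add: strictly_diagonally_dominant_def sdd_row_def b_def)
  have "offdiag_sum B i \<ge> 0"
    by (simp add: offdiag_sum_def sum_nonneg)
  with sdd have b: "cmod b > 0"
    by linarith
  with sdd \<open>offdiag_sum B i \<ge> 0\<close> have r: "0 \<le> r" "r < 1"
    by (simp_all add: r_def)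
  have "cmod b * cmod w = cmod (a - z * b)"
    using b by (simp add: w_def norm_mult[symmetric] algebra_simps norm_minus_commute)
  also have "\<dots> \<le> (\<Sum>j\<in>UNIV - {i}. cmod (A $ i $ j - z * B $ i $ j))"
    using \<open>\<not> sdd_row ?M i\<close> by (simp add: sdd_row_def offdiag_sum_def a_def b_def)
  also have "\<dots> \<le> (\<Sum>j\<in>UNIV - {i}. cmod (A $ i $ j) + cmod z * cmod (B $ i $ j))"
    by (intro sum_mono) (metis norm_mult norm_triangle_ineq4)
  also have "\<dots> = R + cmod z * (r * cmod b)"
    using b by (simp add: R_def r_def offdiag_sum_def sum.distrib sum_distrib_left)
  also have "\<dots> \<le> R + (cmod w + cmod a / cmod b) * (r * cmod b)"
    using norm_triangle_ineq[of w "a / b"] r b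
    by (intro add_left_mono mult_right_mono) (simp_all add: w_def norm_divide)
  also have "\<dots> = R + cmod w * r * cmod b + cmod a * r"
    using b by (simp add: field_simps)
  \<comment> \<open>The term with \<open>cmod w\<close> on the right is absorbed into the left;
    dividing afterwards relies on \<open>r < 1\<close>.\<close>
  finally have "cmod w * (cmod b * (1 - r)) \<le> cmod a * r + R"
    by (simp add: algebra_simps)
  then have "cmod w \<le> (cmod a * r + R) / (cmod b * (1 - r))"
    using b r by (simp add: pos_le_divide_eq)
  then have "Some z \<in> Gamma_B A B i"
    by (simp add: Gamma_B_def Let_def w_def a_def b_def r_def R_def)
  then show ?thesis ..
qed

theorem corollary2p6:
  fixes A B :: "complex^'n^'n::finite"
  assumes "strictly_diagonally_dominant B"
  shows "(\<forall>i. Gamma_S_row A B i = Gamma_B A B i) \<and>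
         size (finite_eigenvalues A B) = CARD('n) \<and>
         (\<forall>l \<in># finite_eigenvalues A B. Some l \<in> Gamma_S A B) \<and>
         Gamma_S A B = (\<Union>i. Gamma_B A B i)"
proof -
  have row: "Gamma_S_row A B i = Gamma_B A B i" for i
    using assms by (simp add: Gamma_S_row_def strictly_diagonally_dominant_def)
  have deg: "degree (pencil_poly A B) = CARD('n)"
    using assms by (rule degree_pencil_poly)
  \<comment> \<open>The zero polynomial has degree 0, whereas \<open>CARD('n)\<close> is
    positive.\<close>
  then have "pencil_poly A B \<noteq> 0"
    by auto
  then have "\<exists>i. Some l \<in> Gamma_B A B i" if "l \<in># finite_eigenvalues A B" for l
    using that finite_eigenvalue_in_Gamma_B[OF assms] by (simp add: set_mset_finite_eigenvalues)
  \<comment> \<open>Over the complex numbers a polynomial has as many roots, with multiplicity, as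
    its degree.\<close>
  then show ?thesis
    using deg by (auto simp: row Gamma_S_def finite_eigenvalues_def size_proots_complex)
qed

end
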